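(* The following equation is a special case of the equation $( * )$ described in the context, and the numbers covered by it have a numerical triangle structure. For every positive integer $k$, and every positive integer $r$ (with $r\ge2$ if $k=1$), $$\frac{k}{k(kr-1)t-(kr+(k-1))}=\frac{1}{(kr-1)t-1}+\frac{1}{\bigl(k(kr-1)t-(kr+(k-1))\bigr)t}+\frac{1}{\bigl(k(kr-1)t-(kr+(k-1))\bigr)\bigl((kr-1)t-1\bigr)t}$$ for all positive integers $t$ if $k\ge3$; for all positive integers $t$ if $k=2$ and $r\ge2$; for all integers $t\ge2$ if $k=2$ and $r=1$; and for all positive integers $t>\frac{r}{r-1}$ if $k=1$. In this equation, for each positive integer $k$ the values covered by the equation (the denominators on the left) have a numerical triangle pattern, as follows: $$m(r,t)=k(kr-1)t-(kr+(k-1))\qquad\text{for all positive integers } r,t.$$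
   Context: Numerical triangle pattern: $M(k,a,d;r,t):=(ra+(r-1)k)t-(d+(r-1)k)$ represents the pattern of a set of symmetric numerical triangles, where $k,r,t$ are positive integers and $a,d$ are positive integers with $ra>d$. For given $k,a,d$ one obtains a triangle with entries $m(r,t)=(ra+(r-1)k)t-(d+(r-1)k)$, $r,t\ge1$, whose $N$-th row consists of the entries at $(r,t)=(1,N),(2,N-1),\dots,(N,1)$. Equation $( * )$: for all positive integers $k,a,\omega$ there exist positive integers $b,c$ with $c>b$ and $k=|b-c|$, and $$\frac{k}{k(a\omega+b)t-(a\omega+c)}=\frac{1}{(a\omega+b)t-1}+\frac{1}{(k(a\omega+b)t-(a\omega+c))t}+\frac{1}{(k(a\omega+b)t-(a\omega+c))((a\omega+b)t-1)t}$$ for all positive integers $t>\frac{a\omega+c}{k(a\omega+b)}$.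
   Formalization: When kr = 2 the special case of ( * ) has b = 0 instead of b positive; in the triangle pattern, a = 0 is allowed for k = 1, and ra > d is not claimed for k = 1 or for k = 2, r = 1, since these conditions fail there. *)

theory Defs
  imports Complex_Main
begin

text \<open>Equation (*): for all \<open>k, a, \<omega> > 0\<close> there are \<open>c > b > 0\<close> with \<open>k = \<bar>b - c\<bar>\<close> such that \<open>star_eq\<close> holds
  for every \<open>t\<close> in \<open>star_range\<close>. As \<open>x / 0 = 0\<close> in HOL, non-vanishing of the denominators is made part of
  \<open>star_eq\<close>.\<close>

definition star_eq :: "int \<Rightarrow> int \<Rightarrow> int \<Rightarrow> int \<Rightarrow> int \<Rightarrow> int \<Rightarrow> bool" where
  "star_eq k a \<omega> b c t \<longleftrightarrow>
     k * (a * \<omega> + b) * t - (a * \<omega> + c) \<noteq> 0 \<and> (a * \<omega> + b) * t - 1 \<noteq> 0 \<and> t \<noteq> 0 \<and>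
     real_of_int k / real_of_int (k * (a * \<omega> + b) * t - (a * \<omega> + c)) =
       1 / real_of_int ((a * \<omega> + b) * t - 1)
     + 1 / real_of_int ((k * (a * \<omega> + b) * t - (a * \<omega> + c)) * t)
     + 1 / real_of_int ((k * (a * \<omega> + b) * t - (a * \<omega> + c)) * ((a * \<omega> + b) * t - 1) * t)"

definition star_range :: "int \<Rightarrow> int \<Rightarrow> int \<Rightarrow> int \<Rightarrow> int \<Rightarrow> int \<Rightarrow> bool" where
  "star_range k a \<omega> b c t \<longleftrightarrow>
     t > 0 \<and> real_of_int t > real_of_int (a * \<omega> + c) / real_of_int (k * (a * \<omega> + b))"

text \<open>Positivity of the parameters is imposed where \<open>star_instance\<close> is used: the special case
  \<open>a * \<omega> + b = k * r - 1\<close>, \<open>a * \<omega> + c = k * r + (k - 1)\<close> admits positive \<open>a, \<omega>, b\<close> only if \<open>k * r > 2\<close>. For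
  \<open>k * r = 2\<close> the boundary value \<open>b = 0\<close> is used instead.\<close>

definition star_instance :: "int \<Rightarrow> int \<Rightarrow> int \<Rightarrow> int \<Rightarrow> int \<Rightarrow> bool" where
  "star_instance k a \<omega> b c \<longleftrightarrow>
     c > b \<and> k = \<bar>b - c\<bar> \<and> (\<forall>t. star_range k a \<omega> b c t \<longrightarrow> star_eq k a \<omega> b c t)"

definition covered_range :: "int \<Rightarrow> int \<Rightarrow> int \<Rightarrow> bool" where
  "covered_range k r t \<longleftrightarrow> t > 0 \<and>
     (k \<ge> 3 \<or>
      (k = 2 \<and> r \<ge> 2) \<or>
      (k = 2 \<and> r = 1 \<and> t \<ge> 2) \<or>
      (k = 1 \<and> r \<ge> 2 \<and> real_of_int t > real_of_int r / real_of_int (r - 1)))"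

text \<open>Triangles with this pattern normally have \<open>a, d > 0\<close> and \<open>r * a > d\<close>. The polynomial identity
  \<open>(r a + (r - 1) k) t - (d + (r - 1) k) = k (k r - 1) t - (k r + (k - 1))\<close> forces \<open>a = k (k - 1)\<close> and
  \<open>d = 2 k - 1\<close>, so these constraints degenerate for \<open>k = 1\<close> (where \<open>a = 0\<close>) and for \<open>k = 2\<close>, \<open>r = 1\<close>.\<close>

definition triangle_pattern :: "int \<Rightarrow> int \<Rightarrow> int \<Rightarrow> int \<Rightarrow> int \<Rightarrow> int" where
  "triangle_pattern k a d r t = (r * a + (r - 1) * k) * t - (d + (r - 1) * k)"

text \<open>The \<open>N\<close>-th row consists of the entries at \<open>(1, N), (2, N - 1), \<dots>, (N, 1)\<close>.\<close>

definition triangle_row :: "(int \<Rightarrow> int \<Rightarrow> int) \<Rightarrow> nat \<Rightarrow> int list" where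
  "triangle_row m N = map (\<lambda>i. m (int i) (int (N + 1 - i))) [1..<N + 1]"

end

theory Submission
  imports Defs
begin

text \<open>Write \<open>A = k r - 1\<close>, \<open>E = A t - 1\<close> and \<open>D = k A t - (A + k)\<close>. Then \<open>D + A = k E\<close>, so putting the
  three unit fractions over the common denominator \<open>D E t\<close> gives the numerator
  \<open>D t + E + 1 = (D + A) t = k E t\<close>, and the sum collapses to \<open>k / D\<close> (\<open>unit_fraction_identity\<close>). The
  same relation \<open>D + A = k E\<close> shows that \<open>D > 0\<close> forces \<open>E > 0\<close> when \<open>A > 0\<close>, so every denominator is
  nonzero as soon as \<open>D > 0\<close>. That last inequality is exactly the range condition of equation (*), and
  for \<open>A = k r - 1\<close> it amounts to the case distinction on \<open>k\<close> and \<open>r\<close>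
  (\<open>covered_range_iff_denominator_pos\<close>). The parameters \<open>a = \<omega> = 1\<close>, \<open>b = k r - 2\<close>, \<open>c = b + k\<close>
  place the equation inside the family (*).

  For the triangle, the denominators expand to \<open>k\<^sup>2 r t - k (r + t) - (k - 1)\<close>, which is symmetric in \<open>r\<close>
  and \<open>t\<close>; hence every row is a palindrome.\<close>

lemma unit_fraction_identity:
  fixes k A D E t :: "'a :: field"
  assumes "D \<noteq> 0" "E \<noteq> 0" "t \<noteq> 0" and E: "E = A * t - 1" and D: "D + A = k * E"
  shows "k / D = 1 / E + 1 / (D * t) + 1 / (D * E * t)"
proof -
  have "1 / E + 1 / (D * t) + 1 / (D * E * t) = (D * t + E + 1) / (D * E * t)"
    using assms(1-3) by (simp add: divide_simps)
  also have "D * t + E + 1 = (D + A) * t"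
    by (simp add: E algebra_simps)
  also have "\<dots> / (D * E * t) = k / D"
    using assms(1-3) by (simp add: D)
  finally show ?thesis by simp
qed

text \<open>The range of (*) is stated with a quotient; clearing the positive denominator turns it into
  positivity of the left-hand denominator.\<close>

lemma star_range_iff_denominator_pos:
  assumes "k > 0" "a * \<omega> + b > 0"
  shows "star_range k a \<omega> b c t \<longleftrightarrow> t > 0 \<and> k * (a * \<omega> + b) * t - (a * \<omega> + c) > 0"
proof -
  have pos: "real_of_int (k * (a * \<omega> + b)) > 0"
    using assms by (simp only: of_int_0_less_iff zero_less_mult_iff) simp
  have "real_of_int (a * \<omega> + c) / real_of_int (k * (a * \<omega> + b)) < real_of_int t \<longleftrightarrow>
      real_of_int (a * \<omega> + c) < real_of_int t * real_of_int (k * (a * \<omega> + b))"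
    using pos by (rule pos_divide_less_eq)
  also have "\<dots> \<longleftrightarrow> a * \<omega> + c < t * (k * (a * \<omega> + b))"
    by (simp only: of_int_mult [symmetric] of_int_less_iff)
  also have "\<dots> \<longleftrightarrow> k * (a * \<omega> + b) * t - (a * \<omega> + c) > 0"
    by (simp add: mult.commute)
  finally show ?thesis
    by (auto simp: star_range_def)
qed

text \<open>The hypothesis \<open>c = b + k\<close> is what makes \<open>D + A = k E\<close> true; that relation then yields both
  the identity and the positivity of \<open>E\<close>.\<close>

lemma star_eqI:
  assumes "k > 0" "a * \<omega> + b > 0" "c = b + k" "t > 0"
    and D_pos: "k * (a * \<omega> + b) * t - (a * \<omega> + c) > 0"
  shows "star_eq k a \<omega> b c t"
proof -
  define A where "A = a * \<omega> + b"
  define D where "D = k * (a * \<omega> + b) * t - (a * \<omega> + c)"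
  define E where "E = (a * \<omega> + b) * t - 1"
  have DA: "D + A = k * E"
    using \<open>c = b + k\<close> by (simp add: A_def D_def E_def algebra_simps)
  have "D > 0"
    using D_pos by (simp add: D_def)
  have "k * E > 0"
    using DA \<open>D > 0\<close> assms(2) by (simp add: A_def)
  then have "E > 0"
    using \<open>k > 0\<close> by (simp add: zero_less_mult_iff)
  have "real_of_int k / real_of_int D
      = 1 / real_of_int E + 1 / (real_of_int D * real_of_int t)
        + 1 / (real_of_int D * real_of_int E * real_of_int t)"
  proof (rule unit_fraction_identity)
    show "real_of_int E = real_of_int A * real_of_int t - 1"
      by (simp add: A_def E_def)
    show "real_of_int D + real_of_int A = real_of_int k * real_of_int E"
      by (simp only: DA of_int_mult [symmetric] of_int_add [symmetric])
  qed (use \<open>D > 0\<close> \<open>E > 0\<close> \<open>t > 0\<close> in auto)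
  then show ?thesis
    using \<open>D > 0\<close> \<open>E > 0\<close> \<open>t > 0\<close>
    unfolding star_eq_def D_def [symmetric] E_def [symmetric] by simp
qed

lemma star_instance_add:
  assumes "k > 0" "a * \<omega> + b > 0"
  shows "star_instance k a \<omega> b (b + k)"
  unfolding star_instance_def
  using assms by (auto simp: star_range_iff_denominator_pos intro: star_eqI)

text \<open>For \<open>k \<ge> 3\<close>, and for \<open>k = 2\<close> with \<open>r \<ge> 2\<close>, the denominator increases with \<open>t\<close> and is
  already positive at \<open>t = 1\<close>, where its value is \<open>k (k - 1) r - (2 k - 1)\<close>. For \<open>k = 2\<close>, \<open>r = 1\<close> it is \<open>2 t - 3\<close>, and for \<open>k = 1\<close> it is
  \<open>(r - 1) t - r\<close>; these are the two cases in which \<open>t\<close> is restricted further.\<close>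

lemma covered_range_iff_denominator_pos:
  assumes "k > 0" "r > 0" "k = 1 \<longrightarrow> r \<ge> 2"
  shows "covered_range k r t \<longleftrightarrow> t > 0 \<and> k * (k * r - 1) * t - (k * r + (k - 1)) > 0"
proof -
  have at_one: "k * (k * r - 1) * t - (k * r + (k - 1)) > 0"
    if "t > 0" "k * (k - 1) * r > 2 * k - 1"
  proof -
    have "k * r > 0"
      using assms by simp
    then have "k * (k * r - 1) \<ge> 0"
      using assms(1) by (intro mult_nonneg_nonneg) linarith+
    then have "k * (k * r - 1) * 1 \<le> k * (k * r - 1) * t"
      using \<open>t > 0\<close> by (intro mult_left_mono) auto
    moreover have "k * (k * r - 1) - (k * r + (k - 1)) = k * (k - 1) * r - (2 * k - 1)"
      by (simp add: algebra_simps)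
    ultimately show ?thesis
      using that(2) by linarith
  qed
  consider "k \<ge> 3" | "k = 2" "r \<ge> 2" | "k = 2" "r = 1" | "k = 1" "r \<ge> 2"
    using assms by linarith
  then show ?thesis
  proof cases
    case 1
    have "k * 2 \<le> k * (k - 1)"
      using 1 by (intro mult_left_mono) auto
    also have "\<dots> * 1 \<le> k * (k - 1) * r"
      using 1 \<open>r > 0\<close> by (intro mult_left_mono) auto
    finally have "k * (k - 1) * r > 2 * k - 1"
      by linarith
    with at_one show ?thesis
      using 1 by (auto simp: covered_range_def)
  next
    case 2
    then show ?thesis
      using at_one by (auto simp: covered_range_def)
  next
    case 3
    then show ?thesis
      by (auto simp: covered_range_def)
  next
    case 4
    have "real_of_int r / real_of_int (r - 1) < real_of_int t
        \<longleftrightarrow> real_of_int r < real_of_int t * real_of_int (r - 1)"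
      using 4 by (intro pos_divide_less_eq) simp
    also have "\<dots> \<longleftrightarrow> r < t * (r - 1)"
      by (simp only: of_int_mult [symmetric] of_int_less_iff)
    finally show ?thesis
      using 4 by (auto simp: covered_range_def mult.commute)
  qed
qed

text \<open>The parameters are forced: the coefficients of \<open>r t\<close> give \<open>a + k = k\<^sup>2\<close> and the constant terms give
  \<open>d - k = k - 1\<close>.\<close>

lemma triangle_pattern_denominators:
  "triangle_pattern k (k * (k - 1)) (2 * k - 1)
    = (\<lambda>r t. k * (k * r - 1) * t - (k * r + (k - 1)))"
  by (simp add: fun_eq_iff triangle_pattern_def algebra_simps)

lemma rev_triangle_row:
  assumes "\<And>r t. m r t = m t r"
  shows "rev (triangle_row m N) = triangle_row m N"
proof (rule nth_equalityI)
  fix i assume "i < length (rev (triangle_row m N))"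
  then have "i < N"
    by (simp add: triangle_row_def del: upt_Suc)
  \<comment> \<open>Position \<open>i\<close> carries the entry at \<open>(i + 1, N - i)\<close>, and its mirror image the entry at
    \<open>(N - i, i + 1)\<close>.\<close>
  then show "rev (triangle_row m N) ! i = triangle_row m N ! i"
    using assms [of "int (N - i)" "int (Suc i)"]
    by (simp add: triangle_row_def rev_nth Suc_diff_Suc del: upt_Suc)
qed (simp add: triangle_row_def)

theorem corollary5p15:
  fixes k :: int
  assumes "k > 0"
  shows
    "(\<forall>r>0. (k = 1 \<longrightarrow> r \<ge> 2) \<longrightarrow>
        (\<exists>a \<omega> b c. a > 0 \<and> \<omega> > 0 \<and> (if k * r = 2 then b = 0 else b > 0) \<and> c > 0 \<and>
           star_instance k a \<omega> b c \<and>
           a * \<omega> + b = k * r - 1 \<and> a * \<omega> + c = k * r + (k - 1) \<and>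
           (\<forall>t. covered_range k r t \<longleftrightarrow> star_range k a \<omega> b c t)) \<and>
        (\<forall>t. covered_range k r t \<longrightarrow>
           k * (k * r - 1) * t - (k * r + (k - 1)) \<noteq> 0 \<and> (k * r - 1) * t - 1 \<noteq> 0 \<and>
           real_of_int k / real_of_int (k * (k * r - 1) * t - (k * r + (k - 1))) =
             1 / real_of_int ((k * r - 1) * t - 1)
           + 1 / real_of_int ((k * (k * r - 1) * t - (k * r + (k - 1))) * t)
           + 1 / real_of_int
               ((k * (k * r - 1) * t - (k * r + (k - 1))) * ((k * r - 1) * t - 1) * t)))
     \<and> (\<exists>a d. a \<ge> 0 \<and> (k \<ge> 2 \<longrightarrow> a > 0) \<and> d > 0 \<and>
          (\<forall>r>0. k \<ge> 3 \<or> (k = 2 \<and> r \<ge> 2) \<longrightarrow> r * a > d) \<and>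
          (\<forall>r>0. \<forall>t>0. triangle_pattern k a d r t = k * (k * r - 1) * t - (k * r + (k - 1))) \<and>
          (\<forall>N>0. triangle_row (triangle_pattern k a d) N =
                 triangle_row (\<lambda>r t. k * (k * r - 1) * t - (k * r + (k - 1))) N) \<and>
          (\<forall>N>0. rev (triangle_row (triangle_pattern k a d) N) =
                 triangle_row (triangle_pattern k a d) N))"
proof (intro conjI allI impI)
  fix r :: int
  assume r: "r > 0" "k = 1 \<longrightarrow> r \<ge> 2"
  have kr: "k * r \<ge> 2"
  proof (cases "k = 1")
    case False
    then have "2 * 1 \<le> k * r"
      using assms r by (intro mult_mono) auto
    then show ?thesis by simp
  qed (use r in simp)
  \<comment> \<open>With \<open>a = \<omega> = 1\<close> the value \<open>b = k r - 2\<close> vanishes exactly when \<open>k r = 2\<close>.\<close>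
  define b where "b = k * r - 2"
  have A: "1 * 1 + b = k * r - 1" and C: "1 * 1 + (b + k) = k * r + (k - 1)"
    by (simp_all add: b_def)
  have A_pos: "1 * 1 + b > 0"
    using kr by (simp add: b_def)
  have inst: "star_instance k 1 1 b (b + k)"
    using assms A_pos by (rule star_instance_add)
  have range: "covered_range k r t \<longleftrightarrow> star_range k 1 1 b (b + k) t" for t
    unfolding star_range_iff_denominator_pos [OF assms A_pos] A C
    using assms r by (rule covered_range_iff_denominator_pos)
  show "\<exists>a \<omega> b c. a > 0 \<and> \<omega> > 0 \<and> (if k * r = 2 then b = 0 else b > 0) \<and> c > 0 \<and>
      star_instance k a \<omega> b c \<and>
      a * \<omega> + b = k * r - 1 \<and> a * \<omega> + c = k * r + (k - 1) \<and>
      (\<forall>t. covered_range k r t \<longleftrightarrow> star_range k a \<omega> b c t)"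
  proof (rule exI [of _ 1], rule exI [of _ 1], rule exI [of _ b], rule exI [of _ "b + k"],
      intro conjI)
    show "if k * r = 2 then b = 0 else b > 0" "b + k > 0"
      using kr assms by (auto simp: b_def)
  qed (use inst range A C in auto)

  fix t assume "covered_range k r t"
  then have "star_eq k 1 1 b (b + k) t"
    using inst range by (simp add: star_instance_def)
  then show "k * (k * r - 1) * t - (k * r + (k - 1)) \<noteq> 0" "(k * r - 1) * t - 1 \<noteq> 0"
    "real_of_int k / real_of_int (k * (k * r - 1) * t - (k * r + (k - 1))) =
       1 / real_of_int ((k * r - 1) * t - 1)
     + 1 / real_of_int ((k * (k * r - 1) * t - (k * r + (k - 1))) * t)
     + 1 / real_of_int
         ((k * (k * r - 1) * t - (k * r + (k - 1))) * ((k * r - 1) * t - 1) * t)"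
    unfolding star_eq_def A C by blast+
next
  let ?a = "k * (k - 1)" and ?d = "2 * k - 1"
  have "r * ?a > ?d" if "r > 0" "k \<ge> 3 \<or> (k = 2 \<and> r \<ge> 2)" for r
  proof (cases "k = 2")
    case False
    then have "k * 2 \<le> ?a"
      using that by (intro mult_left_mono) auto
    also have "1 * \<dots> \<le> r * ?a"
      using assms that by (intro mult_right_mono) auto
    finally show ?thesis by simp
  qed (use that in simp)
  moreover have "rev (triangle_row (triangle_pattern k ?a ?d) N)
      = triangle_row (triangle_pattern k ?a ?d) N" for N
    unfolding triangle_pattern_denominators
    by (rule rev_triangle_row) (simp add: algebra_simps)
  ultimately show "\<exists>a d. a \<ge> 0 \<and> (k \<ge> 2 \<longrightarrow> a > 0) \<and> d > 0 \<and>
      (\<forall>r>0. k \<ge> 3 \<or> (k = 2 \<and> r \<ge> 2) \<longrightarrow> r * a > d) \<and>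
      (\<forall>r>0. \<forall>t>0. triangle_pattern k a d r t = k * (k * r - 1) * t - (k * r + (k - 1))) \<and>
      (\<forall>N>0. triangle_row (triangle_pattern k a d) N =
             triangle_row (\<lambda>r t. k * (k * r - 1) * t - (k * r + (k - 1))) N) \<and>
      (\<forall>N>0. rev (triangle_row (triangle_pattern k a d) N) =
             triangle_row (triangle_pattern k a d) N)"
    using assms
    by - (rule exI [of _ ?a], rule exI [of _ ?d], simp add: triangle_pattern_denominators)
qed

end
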